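(* Let $p_1>0$, $p_2\ne0$, $\rho>0$, and consider the system $$\mathcal{D}'=2\mathcal{I}(p_1\mathcal{D}+p_2\mathcal{R}),\qquad\mathcal{R}'=2\mathcal{I}(-p_2\mathcal{D}+p_1\mathcal{R}),\qquad\mathcal{I}'=-2p_1(\mathcal{D}^2+\mathcal{R}^2)$$ on $S_\rho^2$. The two points $(\mathcal{D},\mathcal{R},\mathcal{I})=\pm(0,0,\rho)$ are fixed points. If $(\mathcal{D}(0),\mathcal{R}(0),\mathcal{I}(0))\ne\pm(0,0,\rho)$, then the solution is given by $$\mathcal{D}(\tau)=\rho\,\frac{\cos\Big(\tau_0+\frac{p_2}{p_1}\log\big((\rho-\mathcal{I}(0))e^{2p_1\rho\tau}+(\rho+\mathcal{I}(0))e^{-2p_1\rho\tau}\big)\Big)}{\cosh\big(2p_1\rho\tau-\tanh^{-1}\frac{\mathcal{I}(0)}{\rho}\big)},$$ $$\mathcal{R}(\tau)=\rho\,\frac{\sin\Big(\tau_0+\frac{p_2}{p_1}\log\big((\rho-\mathcal{I}(0))e^{2p_1\rho\tau}+(\rho+\mathcal{I}(0))e^{-2p_1\rho\tau}\big)\Big)}{\cosh\big(2p_1\rho\tau-\tanh^{-1}\frac{\mathcal{I}(0)}{\rho}\big)},$$ $$\mathcal{I}(\tau)=-\rho\tanh\big(2p_1\rho\tau-\tanh^{-1}\tfrac{\mathcal{I}(0)}{\rho}\big),$$ where $\tau_0$ is given by the relation $$\Big(\cos\big(\tau_0+\tfrac{p_2}{p_1}\log(2\rho)\big),\ \sin\b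ig(\tau_0+\tfrac{p_2}{p_1}\log(2\rho)\big)\Big)=(\mathcal{D}(0)^2+\mathcal{R}(0)^2)^{-\frac12}(\mathcal{D}(0),\mathcal{R}(0)).$$
   Context: $S^2_\rho=\{(x,y,z)\in\mathbb{R}^3: x^2+y^2+z^2=\rho^2\}$; the unknown $(\mathcal{D},\mathcal{R},\mathcal{I})$ is real valued with initial data in $S_\rho^2$, $\tau\in\mathbb{R}$, and the system preserves $S^2_\rho$. *)

theory Defs
  imports "HOL-Analysis.Analysis"
begin

type_synonym state = "real \<times> real \<times> real"

definition S2 :: "real \<Rightarrow> state set" where
  "S2 \<rho> = {(x, y, z). x\<^sup>2 + y\<^sup>2 + z\<^sup>2 = \<rho>\<^sup>2}"

definition vfield :: "real \<Rightarrow> real \<Rightarrow> state \<Rightarrow> state" where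
  "vfield p1 p2 = (\<lambda>(D, R, I).
     (2 * I * (p1 * D + p2 * R), 2 * I * (- p2 * D + p1 * R), - 2 * p1 * (D\<^sup>2 + R\<^sup>2)))"

(* Values in the sphere are not demanded here: only the initial datum is placed on the
   sphere, and its invariance is a property of the system. For a time set T with end points
   the derivative there is one-sided. *)
definition solves_on :: "real \<Rightarrow> real \<Rightarrow> real set \<Rightarrow> (real \<Rightarrow> state) \<Rightarrow> bool" where
  "solves_on p1 p2 T u \<longleftrightarrow>
     (\<forall>\<tau>\<in>T. (u has_vector_derivative vfield p1 p2 (u \<tau>)) (at \<tau> within T))"

definition fixed_point_on :: "real \<Rightarrow> real \<Rightarrow> state set \<Rightarrow> state \<Rightarrow> bool" where
  "fixed_point_on p1 p2 S x \<longleftrightarrow> x \<in> S \<and> vfield p1 p2 x = 0"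

definition phase :: "real \<Rightarrow> real \<Rightarrow> real \<Rightarrow> real \<Rightarrow> real \<Rightarrow> real \<Rightarrow> real" where
  "phase p1 p2 \<rho> \<tau>0 I0 \<tau> =
     \<tau>0 + p2 / p1 * ln ((\<rho> - I0) * exp (2 * p1 * \<rho> * \<tau>) + (\<rho> + I0) * exp (- 2 * p1 * \<rho> * \<tau>))"

definition explicit_solution ::
    "real \<Rightarrow> real \<Rightarrow> real \<Rightarrow> real \<Rightarrow> real \<Rightarrow> real \<Rightarrow> state" where
  "explicit_solution p1 p2 \<rho> \<tau>0 I0 \<tau> =
     (\<rho> * (cos (phase p1 p2 \<rho> \<tau>0 I0 \<tau>) / cosh (2 * p1 * \<rho> * \<tau> - artanh (I0 / \<rho>))),
      \<rho> * (sin (phase p1 p2 \<rho> \<tau>0 I0 \<tau>) / cosh (2 * p1 * \<rho> * \<tau> - artanh (I0 / \<rho>))),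
      - \<rho> * tanh (2 * p1 * \<rho> * \<tau> - artanh (I0 / \<rho>)))"

definition phase_relation ::
    "real \<Rightarrow> real \<Rightarrow> real \<Rightarrow> real \<Rightarrow> real \<Rightarrow> real \<Rightarrow> bool" where
  "phase_relation p1 p2 \<rho> D0 R0 \<tau>0 \<longleftrightarrow>
     (cos (\<tau>0 + p2 / p1 * ln (2 * \<rho>)), sin (\<tau>0 + p2 / p1 * ln (2 * \<rho>)))
       = ((D0\<^sup>2 + R0\<^sup>2) powr (- 1 / 2)) *\<^sub>R (D0, R0)"

end

theory Submission
  imports Defs
begin

text \<open>
  On the sphere, \<open>I' = -2 p\<^sub>1 (\<rho>\<^sup>2 - I\<^sup>2)\<close> is a Riccati equation, and \<open>z = D + \<i> R\<close> satisfies
  \<open>z' = 2 I (p\<^sub>1 - \<i> p\<^sub>2) z\<close>. Writing \<open>I(0) = \<rho> tanh a\<close> and \<open>s = 2 p\<^sub>1 \<rho> \<tau> - a\<close>, the argument of the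
  logarithm in the phase is \<open>2 \<rho> cosh s / cosh a\<close>, from which the formula can be differentiated
  directly. For uniqueness, \<open>D\<^sup>2 + R\<^sup>2 + I\<^sup>2\<close> is conserved; hence the difference of the \<open>I\<close>-components
  of two solutions solves a scalar linear equation with bounded coefficient, and so vanishes; then
  \<open>|z\<^sub>1 - z\<^sub>2|\<^sup>2\<close> also solves such an equation.
\<close>

section \<open>The system in components\<close>

lemma has_vector_derivative_Pair_iff:
  "((\<lambda>x. (f x, g x)) has_vector_derivative (a, b)) (at x within S) \<longleftrightarrow>
     (f has_vector_derivative a) (at x within S) \<and> (g has_vector_derivative b) (at x within S)"
  using bounded_linear.has_vector_derivative[OF bounded_linear_fst, of "\<lambda>x. (f x, g x)" "(a, b)"]
    bounded_linear.has_vector_derivative[OF bounded_linear_snd, of "\<lambda>x. (f x, g x)" "(a, b)"]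
  by (auto intro: has_vector_derivative_Pair)

lemma solves_on_components:
  "solves_on p1 p2 T (\<lambda>t. (D t, R t, I t)) \<longleftrightarrow>
     (\<forall>t\<in>T.
       (D has_real_derivative 2 * I t * (p1 * D t + p2 * R t)) (at t within T) \<and>
       (R has_real_derivative 2 * I t * (- p2 * D t + p1 * R t)) (at t within T) \<and>
       (I has_real_derivative - 2 * p1 * ((D t)\<^sup>2 + (R t)\<^sup>2)) (at t within T))"
  by (simp add: solves_on_def vfield_def has_vector_derivative_Pair_iff
      has_real_derivative_iff_has_vector_derivative)

section \<open>Scalar linear equations with bounded coefficient\<close>

text \<open>A Gronwall argument: since \<open>a x\<close> is at most \<open>L\<close>, the weight
  \<open>exp (- 2 * L * x)\<close> makes \<open>(f x)\<^sup>2\<close> times it nonincreasing. That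
  product is nonnegative and starts at 0. Squaring \<open>f\<close> avoids any distinction by its
  sign.\<close>

lemma linear_ode_zero_right:
  fixes f a :: "real \<Rightarrow> real"
  assumes "t \<ge> 0"
    and deriv: "\<And>x. x \<in> {0..t} \<Longrightarrow> (f has_real_derivative a x * f x) (at x within {0..t})"
    and bound: "\<And>x. x \<in> {0..t} \<Longrightarrow> \<bar>a x\<bar> \<le> L"
    and "f 0 = 0"
  shows "f t = 0"
proof -
  define g where "g x = (f x)\<^sup>2 * exp (- 2 * L * x)" for x
  have g: "(g has_real_derivative 2 * (a x - L) * g x) (at x within {0..t})"
    if "x \<in> {0..t}" for x
    unfolding g_def
    by (rule derivative_eq_intros deriv[OF that] refl | simp)+
      (simp add: algebra_simps power2_eq_square)
  have "g t \<le> g 0"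
  proof (rule DERIV_nonpos_imp_decreasing_open[OF \<open>t \<ge> 0\<close>])
    fix x assume x: "0 < x" "x < t"
    then have "x \<in> {0..t}" by simp
    have "(g has_real_derivative 2 * (a x - L) * g x) (at x within {0<..<t})"
      by (rule has_field_derivative_subset[OF g[OF \<open>x \<in> {0..t}\<close>]]) auto
    then have "DERIV g x :> 2 * (a x - L) * g x"
      using x by (simp add: at_within_open[of x "{0<..<t}"])
    moreover have "2 * (a x - L) * g x \<le> 0"
      using bound[OF \<open>x \<in> {0..t}\<close>] by (simp add: g_def mult_nonpos_nonneg abs_le_iff)
    ultimately show "\<exists>y. DERIV g x :> y \<and> y \<le> 0" by blast
  next
    show "continuous_on {0..t} g"
      by (rule DERIV_continuous_on[OF g])
  qed
  then have "(f t)\<^sup>2 * exp (- 2 * L * t) \<le> 0"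
    by (simp add: g_def \<open>f 0 = 0\<close>)
  then show ?thesis
    by (simp add: mult_le_0_iff)
qed

text \<open>Negative times reduce to positive ones by reflection: \<open>f (- x)\<close> solves an
  equation of the same kind with coefficient \<open>- a (- x)\<close>, so the bound \<open>L\<close>
  is unchanged. That \<open>T\<close> is an interval keeps the segment between 0 and
  \<open>t\<close> inside \<open>T\<close>.\<close>

lemma linear_ode_zero:
  fixes f a :: "real \<Rightarrow> real"
  assumes T: "is_interval T" "0 \<in> T" "t \<in> T"
    and deriv: "\<And>x. x \<in> T \<Longrightarrow> (f has_real_derivative a x * f x) (at x within T)"
    and bound: "\<And>x. x \<in> T \<Longrightarrow> \<bar>a x\<bar> \<le> L"
    and "f 0 = 0"
  shows "f t = 0"
proof (cases "t \<ge> 0")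
  case True
  have sub: "x \<in> T" if "x \<in> {0..t}" for x
    using that by (intro mem_is_interval_1_I[OF T]) auto
  show ?thesis
  proof (rule linear_ode_zero_right[where f = f and t = t and a = a and L = L])
    show "(f has_real_derivative a x * f x) (at x within {0..t})" if "x \<in> {0..t}" for x
      by (rule has_field_derivative_subset[OF deriv[OF sub[OF that]]]) (use sub in blast)
    show "\<bar>a x\<bar> \<le> L" if "x \<in> {0..t}" for x
      by (rule bound[OF sub[OF that]])
  qed (use True \<open>f 0 = 0\<close> in auto)
next
  case False
  have sub: "- x \<in> T" if "x \<in> {0..- t}" for x
    using that by (intro mem_is_interval_1_I[OF T(1,3,2)]) auto
  have der: "((\<lambda>x. f (- x)) has_real_derivative - a (- x) * f (- x)) (at x within {0..- t})"
    if "x \<in> {0..- t}" for x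
  proof -
    \<comment> \<open>The chain rule within a set asks for the derivative of \<open>f\<close> within
      the reflected segment, which lies in \<open>T\<close>.\<close>
    have "(f has_real_derivative a (- x) * f (- x)) (at (- x) within uminus ` {0..- t})"
      by (rule has_field_derivative_subset[OF deriv[OF sub[OF that]]]) (use sub in blast)
    moreover have "(uminus has_real_derivative - 1) (at x within {0..- t})"
      by (auto intro!: derivative_eq_intros)
    ultimately show ?thesis
      using DERIV_image_chain[of f _ uminus x "{0..- t}" "- 1"] by (simp add: o_def)
  qed
  have "f (- (- t)) = 0"
  proof (rule linear_ode_zero_right[where f = "\<lambda>x. f (- x)" and a = "\<lambda>x. - a (- x)"
        and t = "- t" and L = L, OF _ der])
    show "\<bar>- a (- x)\<bar> \<le> L" if "x \<in> {0..- t}" for x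
      using bound[OF sub[OF that]] by simp
  qed (use False \<open>f 0 = 0\<close> in auto)
  then show ?thesis by simp
qed

section \<open>Conservation of the norm and uniqueness\<close>

text \<open>The vector field is orthogonal to the position: the \<open>p2\<close> terms of
  \<open>D D' + R R'\<close> cancel each other, and the remaining
  \<open>2 * p1 * I * (D\<^sup>2 + R\<^sup>2)\<close> cancels against \<open>I I'\<close>.\<close>

lemma solves_on_norm_conserved:
  assumes T: "is_interval T" "0 \<in> T" "t \<in> T"
    and sol: "solves_on p1 p2 T (\<lambda>t. (D t, R t, I t))"
  shows "(D t)\<^sup>2 + (R t)\<^sup>2 + (I t)\<^sup>2 = (D 0)\<^sup>2 + (R 0)\<^sup>2 + (I 0)\<^sup>2"
proof -
  note der = sol[unfolded solves_on_components, rule_format]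
  have "((\<lambda>t. (D t)\<^sup>2 + (R t)\<^sup>2 + (I t)\<^sup>2) has_real_derivative 0) (at t within T)"
    if "t \<in> T" for t
    using der[OF that]
    by (auto intro!: derivative_eq_intros simp: algebra_simps power2_eq_square)
  then obtain c where "\<forall>t\<in>T. (D t)\<^sup>2 + (R t)\<^sup>2 + (I t)\<^sup>2 = c"
    using has_field_derivative_zero_constant[of T "\<lambda>t. (D t)\<^sup>2 + (R t)\<^sup>2 + (I t)\<^sup>2"]
      is_interval_convex[OF T(1)] by blast
  with T show ?thesis by simp
qed

lemma solves_on_unique:
  assumes T: "is_interval T" "0 \<in> T" "t \<in> T"
    and sol: "solves_on p1 p2 T (\<lambda>t. (D t, R t, I t))" "solves_on p1 p2 T (\<lambda>t. (d t, r t, i t))"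
    and init: "(D 0, R 0, I 0) = (d 0, r 0, i 0)"
  shows "(D t, R t, I t) = (d t, r t, i t)"
proof -
  note der = sol(1)[unfolded solves_on_components, rule_format]
    sol(2)[unfolded solves_on_components, rule_format]
  \<comment> \<open>The squared radius of the sphere through the common initial point. Both
    solutions stay on it, so \<open>sqrt N\<close> bounds both \<open>I\<close> and
    \<open>i\<close>.\<close>
  define N where "N = (d 0)\<^sup>2 + (r 0)\<^sup>2 + (i 0)\<^sup>2"
  have N: "(D x)\<^sup>2 + (R x)\<^sup>2 = N - (I x)\<^sup>2" "(d x)\<^sup>2 + (r x)\<^sup>2 = N - (i x)\<^sup>2" if "x \<in> T" for x
    using solves_on_norm_conserved[OF T(1,2) that sol(1)]
      solves_on_norm_conserved[OF T(1,2) that sol(2)] init by (auto simp: N_def)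
  have bound: "\<bar>I x\<bar> \<le> sqrt N" "\<bar>i x\<bar> \<le> sqrt N" if "x \<in> T" for x
    using N[OF that] zero_le_power2[of "D x"] zero_le_power2[of "R x"]
      zero_le_power2[of "d x"] zero_le_power2[of "r x"]
    by (simp_all only: real_le_rsqrt real_sqrt_abs[symmetric] real_sqrt_le_iff)
  have eq: "I x = i x" if "x \<in> T" for x
  proof -
    \<comment> \<open>Eliminating \<open>D\<close> and \<open>R\<close> through \<open>N\<close>
      decouples the third equation into \<open>I' = - 2 * p1 * (N - I\<^sup>2)\<close>; the
      difference of two such right-hand sides factors as
      \<open>2 * p1 * (I + i) * (I - i)\<close>.\<close>
    have "I x - i x = 0"
    proof (rule linear_ode_zero[where f = "\<lambda>x. I x - i x" and a = "\<lambda>x. 2 * p1 * (I x + i x)"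
          and L = "2 * \<bar>p1\<bar> * (sqrt N + sqrt N)", OF T(1,2) that])
      fix x assume x: "x \<in> T"
      have "((\<lambda>x. I x - i x) has_real_derivative
          - 2 * p1 * ((D x)\<^sup>2 + (R x)\<^sup>2) - - 2 * p1 * ((d x)\<^sup>2 + (r x)\<^sup>2)) (at x within T)"
        using der(1)[OF x] der(2)[OF x] by (intro derivative_intros) auto
      then show "((\<lambda>x. I x - i x) has_real_derivative 2 * p1 * (I x + i x) * (I x - i x))
          (at x within T)"
        unfolding N[OF x] by (simp add: algebra_simps power2_eq_square)
      show "\<bar>2 * p1 * (I x + i x)\<bar> \<le> 2 * \<bar>p1\<bar> * (sqrt N + sqrt N)"
        using bound[OF x] unfolding abs_mult by (intro mult_mono) auto
    qed (use init in simp)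
    then show ?thesis by simp
  qed
  \<comment> \<open>Once \<open>I\<close> and \<open>i\<close> agree, the first two equations are
    the same linear system for both solutions. Its \<open>p2\<close> part is an infinitesimal
    rotation and drops out of the squared distance, leaving the coefficient
    \<open>4 * p1 * I\<close>.\<close>
  have "(D t - d t)\<^sup>2 + (R t - r t)\<^sup>2 = 0"
  proof (rule linear_ode_zero[where f = "\<lambda>x. (D x - d x)\<^sup>2 + (R x - r x)\<^sup>2"
        and a = "\<lambda>x. 4 * p1 * I x" and L = "4 * \<bar>p1\<bar> * sqrt N", OF T])
    fix x assume x: "x \<in> T"
    show "((\<lambda>x. (D x - d x)\<^sup>2 + (R x - r x)\<^sup>2) has_real_derivative
        4 * p1 * I x * ((D x - d x)\<^sup>2 + (R x - r x)\<^sup>2)) (at x within T)"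
      using der(1)[OF x] der(2)[OF x] unfolding eq[OF x]
      by (auto intro!: derivative_eq_intros) (simp add: algebra_simps power2_eq_square)
    show "\<bar>4 * p1 * I x\<bar> \<le> 4 * \<bar>p1\<bar> * sqrt N"
      using bound(1)[OF x] by (auto simp: abs_mult intro!: mult_left_mono)
  qed (use init in simp)
  with eq[OF T(3)] show ?thesis
    by simp
qed

section \<open>Hyperbolic identities and the derivative of the phase\<close>

lemma tanh_artanh_real:
  fixes x :: real
  assumes "\<bar>x\<bar> < 1"
  shows "tanh (artanh x) = x"
proof -
  have pos: "1 + x > 0" "1 - x > 0" using assms by auto
  have "exp (- 2 * artanh x) = (1 - x) / (1 + x)"
    using pos by (simp add: artanh_def exp_minus)
  then show ?thesis
    unfolding tanh_real_altdef \<open>exp (- 2 * artanh x) = (1 - x) / (1 + x)\<close>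
    using pos by (simp add: field_simps)
qed

text \<open>The factors \<open>1 - tanh a\<close> and \<open>1 + tanh a\<close> are
  \<open>exp (- a) / cosh a\<close> and \<open>exp a / cosh a\<close>, so the shift by
  \<open>a\<close> cancels in both exponentials. With \<open>s = 2 * p1 * \<rho> * t - a\<close> the
  left side is the argument of the logarithm in \<open>phase\<close>.\<close>

lemma cosh_shift_real:
  fixes s a \<rho> :: real
  shows "(\<rho> - \<rho> * tanh a) * exp (s + a) + (\<rho> + \<rho> * tanh a) * exp (- (s + a))
    = 2 * \<rho> * cosh s / cosh a"
proof -
  have "(cosh a - sinh a) * exp (s + a) + (cosh a + sinh a) * exp (- (s + a)) = 2 * cosh s"
    unfolding cosh_minus_sinh cosh_plus_sinh by (simp add: cosh_def flip: exp_add)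
  moreover have "(\<rho> - \<rho> * tanh a) * exp (s + a) + (\<rho> + \<rho> * tanh a) * exp (- (s + a))
      = \<rho> / cosh a * ((cosh a - sinh a) * exp (s + a) + (cosh a + sinh a) * exp (- (s + a)))"
    by (simp add: tanh_def distrib_left distrib_right left_diff_distrib right_diff_distrib)
  ultimately show ?thesis
    by simp
qed

lemma phase_tanh:
  "phase p1 p2 \<rho> \<tau>0 (\<rho> * tanh a) t
    = \<tau>0 + p2 / p1 * ln (2 * \<rho> * cosh (2 * p1 * \<rho> * t - a) / cosh a)"
  using cosh_shift_real[of \<rho> a "2 * p1 * \<rho> * t - a"] by (simp add: phase_def)

text \<open>The logarithmic derivative of cosh is tanh, and the constant factor
  \<open>2 * \<rho> / cosh a\<close> only adds a constant to the logarithm.\<close>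

lemma phase_has_derivative:
  assumes "p1 \<noteq> 0" "\<rho> > 0"
  shows "(phase p1 p2 \<rho> \<tau>0 (\<rho> * tanh a) has_real_derivative
    2 * p2 * \<rho> * tanh (2 * p1 * \<rho> * t - a)) (at t)"
proof -
  have "2 * \<rho> * cosh (2 * p1 * \<rho> * t - a) / cosh a > 0"
    using assms by simp
  then show ?thesis
    unfolding phase_tanh[abs_def] using assms
    by (auto intro!: derivative_eq_intros simp: tanh_def field_simps)
qed

lemma sech_has_derivative:
  "((\<lambda>t. 1 / cosh (c * t - a)) has_real_derivative
    - c * tanh (c * t - a) * (1 / cosh (c * t - a))) (at t)"
  for c a t :: real
  by (auto intro!: derivative_eq_intros simp: tanh_def field_simps power2_eq_square)

lemma sech_square_eq: "(1 / cosh s)\<^sup>2 = 1 - (tanh s)\<^sup>2" for s :: real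
proof -
  have "(cosh s)\<^sup>2 \<noteq> 0" by simp
  then show ?thesis
    using cosh_square_eq[of s] by (simp add: tanh_def power_divide divide_simps del: power_eq_0_iff)
qed

section \<open>The explicit formula\<close>

text \<open>With amplitude \<open>\<rho> * q\<close> and angle \<open>\<theta>\<close>, the
  logarithmic derivative of \<open>D + i R\<close> is \<open>q' / q + i \<theta>'\<close>, that is
  \<open>2 * \<rho> * tanh s * (- p1 + i p2)\<close>. This is \<open>2 * I * (p1 - i p2)\<close> for
  \<open>I = - \<rho> * tanh s\<close>.\<close>

lemma explicit_solution_solves:
  assumes "p1 \<noteq> 0" "\<rho> > 0" "\<bar>I0\<bar> < \<rho>"
  shows "solves_on p1 p2 UNIV (explicit_solution p1 p2 \<rho> \<tau>0 I0)"
proof -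
  define a where "a = artanh (I0 / \<rho>)"
  have I0: "I0 = \<rho> * tanh a"
    using assms by (simp add: a_def tanh_artanh_real)
  define s where "s t = 2 * p1 * \<rho> * t - a" for t
  define q where "q t = 1 / cosh (s t)" for t
  define \<theta> where "\<theta> = phase p1 p2 \<rho> \<tau>0 I0"
  have q: "(q has_real_derivative - (2 * p1 * \<rho>) * tanh (s t) * q t) (at t)" for t
    unfolding q_def s_def by (rule sech_has_derivative)
  have \<theta>: "(\<theta> has_real_derivative 2 * p2 * \<rho> * tanh (s t)) (at t)" for t
    unfolding \<theta>_def I0 s_def using assms by (intro phase_has_derivative) auto
  have sol: "explicit_solution p1 p2 \<rho> \<tau>0 I0
      = (\<lambda>t. (\<rho> * (cos (\<theta> t) * q t), \<rho> * (sin (\<theta> t) * q t), - \<rho> * tanh (s t)))"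
    by (simp add: fun_eq_iff explicit_solution_def \<theta>_def q_def s_def a_def)
  have D: "((\<lambda>t. \<rho> * (cos (\<theta> t) * q t)) has_real_derivative
      2 * (- \<rho> * tanh (s t)) * (p1 * (\<rho> * (cos (\<theta> t) * q t)) + p2 * (\<rho> * (sin (\<theta> t) * q t)))) (at t)"
    for t
    by (rule derivative_eq_intros q \<theta> refl)+ (simp add: algebra_simps)
  have R: "((\<lambda>t. \<rho> * (sin (\<theta> t) * q t)) has_real_derivative
      2 * (- \<rho> * tanh (s t)) * (- p2 * (\<rho> * (cos (\<theta> t) * q t)) + p1 * (\<rho> * (sin (\<theta> t) * q t)))) (at t)"
    for t
    by (rule derivative_eq_intros q \<theta> refl)+ (simp add: algebra_simps)
  have I: "((\<lambda>t. - \<rho> * tanh (s t)) has_real_derivative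
      - 2 * p1 * ((\<rho> * (cos (\<theta> t) * q t))\<^sup>2 + (\<rho> * (sin (\<theta> t) * q t))\<^sup>2)) (at t)" for t
  proof -
    have "(\<rho> * (cos (\<theta> t) * q t))\<^sup>2 + (\<rho> * (sin (\<theta> t) * q t))\<^sup>2
        = \<rho>\<^sup>2 * (q t)\<^sup>2 * ((cos (\<theta> t))\<^sup>2 + (sin (\<theta> t))\<^sup>2)"
      by (simp only: power_mult_distrib distrib_left mult_ac)
    also have "\<dots> = \<rho>\<^sup>2 * (1 - (tanh (s t))\<^sup>2)"
      by (simp add: q_def sech_square_eq)
    finally show ?thesis
      unfolding s_def by (auto intro!: derivative_eq_intros simp: power2_eq_square)
  qed
  show ?thesis
    unfolding sol solves_on_components using D R I by blast
qed

lemma explicit_solution_in_S2: "explicit_solution p1 p2 \<rho> \<tau>0 I0 t \<in> S2 \<rho>"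
proof -
  define s where "s = 2 * p1 * \<rho> * t - artanh (I0 / \<rho>)"
  define \<theta> where "\<theta> = phase p1 p2 \<rho> \<tau>0 I0 t"
  have "(\<rho> * (cos \<theta> / cosh s))\<^sup>2 + (\<rho> * (sin \<theta> / cosh s))\<^sup>2 + (- \<rho> * tanh s)\<^sup>2
      = \<rho>\<^sup>2 * ((1 / cosh s)\<^sup>2 * ((cos \<theta>)\<^sup>2 + (sin \<theta>)\<^sup>2) + (tanh s)\<^sup>2)"
    by (simp add: power_divide power_mult_distrib distrib_left
        flip: add_divide_distrib del: sin_cos_squared_add2)
  also have "\<dots> = \<rho>\<^sup>2"
    by (simp only: sech_square_eq sin_cos_squared_add2) simp
  finally show ?thesis
    by (simp add: explicit_solution_def S2_def s_def \<theta>_def)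
qed

text \<open>At time 0 the exponentials are 1 and the argument of the logarithm is
  \<open>2 * \<rho>\<close>, which is where the constant in \<open>phase_relation\<close> comes
  from. The amplitude \<open>\<rho> / cosh a\<close> is the positive root of
  \<open>D0\<^sup>2 + R0\<^sup>2\<close> and cancels the normalising power.\<close>

lemma explicit_solution_0:
  assumes "\<rho> > 0" "\<bar>I0\<bar> < \<rho>" "(D0, R0, I0) \<in> S2 \<rho>"
    and rel: "phase_relation p1 p2 \<rho> D0 R0 \<tau>0"
  shows "explicit_solution p1 p2 \<rho> \<tau>0 I0 0 = (D0, R0, I0)"
proof -
  define a where "a = artanh (I0 / \<rho>)"
  have a: "tanh a = I0 / \<rho>"
    using assms by (simp add: a_def tanh_artanh_real)
  have sphere: "D0\<^sup>2 + R0\<^sup>2 = \<rho>\<^sup>2 - I0\<^sup>2"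
    using assms by (simp add: S2_def)
  have pos: "\<rho>\<^sup>2 - I0\<^sup>2 > 0"
    using assms by (simp add: abs_square_less_1 power2_strict_mono)
  have "(\<rho> / cosh a)\<^sup>2 = \<rho>\<^sup>2 * (1 / cosh a)\<^sup>2"
    by (simp add: power_divide)
  also have "\<dots> = \<rho>\<^sup>2 - I0\<^sup>2"
    unfolding sech_square_eq a using \<open>\<rho> > 0\<close> by (simp add: field_simps)
  finally have "\<rho> / cosh a = sqrt (\<rho>\<^sup>2 - I0\<^sup>2)"
    using \<open>\<rho> > 0\<close> by (intro real_sqrt_unique[symmetric]) auto
  moreover have "(D0\<^sup>2 + R0\<^sup>2) powr (- 1 / 2) = 1 / sqrt (\<rho>\<^sup>2 - I0\<^sup>2)"
    using pos by (simp add: sphere powr_minus_divide powr_half_sqrt)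
  ultimately show ?thesis
    using rel pos \<open>\<rho> > 0\<close>
    by (simp add: explicit_solution_def phase_relation_def phase_def a flip: a_def)
      (simp add: field_simps)
qed

lemma phase_relation_exists:
  assumes "D0\<^sup>2 + R0\<^sup>2 > 0"
  shows "\<exists>\<tau>0. phase_relation p1 p2 \<rho> D0 R0 \<tau>0"
proof -
  define n where "n = (D0\<^sup>2 + R0\<^sup>2) powr (- 1 / 2)"
  have "n\<^sup>2 = (D0\<^sup>2 + R0\<^sup>2) powr (- 1)"
    unfolding n_def power2_eq_square by (simp flip: powr_add)
  then have "(n * D0)\<^sup>2 + (n * R0)\<^sup>2 = 1"
    using assms by (simp add: power_mult_distrib powr_minus_divide sum_power2_gt_zero_iff
        flip: add_divide_distrib)
  then obtain t where "n * D0 = cos t" "n * R0 = sin t"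
    by (rule sincos_total_2pi)
  \<comment> \<open>The polar angle of \<open>(D0, R0)\<close>, corrected by the offset that the
    phase has at time 0.\<close>
  then have "phase_relation p1 p2 \<rho> D0 R0 (t - p2 / p1 * ln (2 * \<rho>))"
    by (simp add: phase_relation_def n_def)
  then show ?thesis ..
qed

text \<open>The formula presupposes a suitable \<open>\<tau>0\<close>, so its existence is part of
  the claim. Agreement is asserted on every interval containing 0, which also covers solutions that
  are only local.\<close>

theorem proposition2p9:
  fixes p1 p2 \<rho> :: real
  assumes "p1 > 0" and "p2 \<noteq> 0" and "\<rho> > 0"
  shows "fixed_point_on p1 p2 (S2 \<rho>) (0, 0, \<rho>) \<and>
    fixed_point_on p1 p2 (S2 \<rho>) (- (0, 0, \<rho>)) \<and>
    (\<forall>D0 R0 I0. (D0, R0, I0) \<in> S2 \<rho> \<longrightarrow>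
       (D0, R0, I0) \<noteq> (0, 0, \<rho>) \<longrightarrow> (D0, R0, I0) \<noteq> - (0, 0, \<rho>) \<longrightarrow>
       (\<exists>\<tau>0. phase_relation p1 p2 \<rho> D0 R0 \<tau>0) \<and>
       (\<forall>\<tau>0. phase_relation p1 p2 \<rho> D0 R0 \<tau>0 \<longrightarrow>
          solves_on p1 p2 UNIV (explicit_solution p1 p2 \<rho> \<tau>0 I0) \<and>
          explicit_solution p1 p2 \<rho> \<tau>0 I0 0 = (D0, R0, I0) \<and>
          (\<forall>\<tau>. explicit_solution p1 p2 \<rho> \<tau>0 I0 \<tau> \<in> S2 \<rho>) \<and>
          (\<forall>T u. is_interval T \<longrightarrow> 0 \<in> T \<longrightarrow> solves_on p1 p2 T u \<longrightarrow> u 0 = (D0, R0, I0) \<longrightarrow>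
             (\<forall>\<tau>\<in>T. u \<tau> = explicit_solution p1 p2 \<rho> \<tau>0 I0 \<tau>))))"
proof (intro conjI allI impI ballI)
  show "fixed_point_on p1 p2 (S2 \<rho>) (0, 0, \<rho>)" "fixed_point_on p1 p2 (S2 \<rho>) (- (0, 0, \<rho>))"
    by (simp_all add: fixed_point_on_def S2_def vfield_def zero_prod_def)
next
  fix D0 R0 I0
  assume S2: "(D0, R0, I0) \<in> S2 \<rho>"
    and ne: "(D0, R0, I0) \<noteq> (0, 0, \<rho>)" "(D0, R0, I0) \<noteq> - (0, 0, \<rho>)"
  \<comment> \<open>The excluded points are the only ones where the sphere meets the
    \<open>I\<close> axis. Away from them \<open>I0 / \<rho>\<close> lies strictly between -1 and 1,
    where artanh inverts tanh.\<close>
  have pos: "D0\<^sup>2 + R0\<^sup>2 > 0"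
  proof (rule ccontr)
    assume "\<not> D0\<^sup>2 + R0\<^sup>2 > 0"
    then have "D0 = 0" "R0 = 0"
      by (simp_all add: sum_power2_gt_zero_iff)
    with S2 ne show False
      by (auto simp: S2_def power2_eq_iff)
  qed
  moreover have "D0\<^sup>2 + R0\<^sup>2 + I0\<^sup>2 = \<rho>\<^sup>2"
    using S2 by (simp add: S2_def)
  ultimately have "\<bar>I0\<bar>\<^sup>2 < \<rho>\<^sup>2"
    by (simp only: power2_abs)
  then have I0: "\<bar>I0\<bar> < \<rho>"
    using \<open>\<rho> > 0\<close> by (intro power2_less_imp_less[of "\<bar>I0\<bar>" \<rho>]) auto
  show "\<exists>\<tau>0. phase_relation p1 p2 \<rho> D0 R0 \<tau>0"
    using pos by (rule phase_relation_exists)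
  fix \<tau>0 assume rel: "phase_relation p1 p2 \<rho> D0 R0 \<tau>0"
  let ?e = "explicit_solution p1 p2 \<rho> \<tau>0 I0"
  show sol: "solves_on p1 p2 UNIV ?e"
    using assms I0 by (intro explicit_solution_solves) auto
  show init: "?e 0 = (D0, R0, I0)"
    using \<open>\<rho> > 0\<close> I0 S2 rel by (rule explicit_solution_0)
  show "?e \<tau> \<in> S2 \<rho>" for \<tau>
    by (rule explicit_solution_in_S2)
  fix T u \<tau>
  assume T: "is_interval T" "0 \<in> T" and u: "solves_on p1 p2 T u" "u 0 = (D0, R0, I0)"
    and "\<tau> \<in> T"
  have "solves_on p1 p2 T ?e"
    using sol unfolding solves_on_def
    by (auto intro: has_vector_derivative_within_subset)
  then show "u \<tau> = ?e \<tau>"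
    using solves_on_unique[OF T \<open>\<tau> \<in> T\<close>, of p1 p2 "\<lambda>t. fst (u t)" "\<lambda>t. fst (snd (u t))" "\<lambda>t. snd (snd (u t))"
        "\<lambda>t. fst (?e t)" "\<lambda>t. fst (snd (?e t))" "\<lambda>t. snd (snd (?e t))"] u init
    by simp
qed

end
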